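(* Let $W$ be a closed subspace of a separable Hilbert space $\mathcal{H}$ and let $\Psi=(\psi_n)_{n=1}^\infty$ be a frame for $W$ (hence a Bessel sequence in $\mathcal{H}$). Consider the frame operator $S_\Psi:\mathcal{H}\to\mathcal{H}$, $S_\Psi h=\sum_{n=1}^\infty\langle h,\psi_n\rangle\psi_n$. Then the following statements hold. (i) $\operatorname{ran}(S_\Psi)=W$, and so the Moore–Penrose inverse $S_\Psi^\dagger$ is well-defined. Moreover, $\operatorname{ran}(S_\Psi^\dagger)=W$. (ii) $\ker(S_\Psi)=W^\perp=\ker(S_\Psi^\dagger)$.
   Context: A sequence $(\psi_n)$ in a closed subspace $W$ of $\mathcal{H}$ is a frame for $W$ if there are $A,B>0$ with $A\|h\|^2\le\sum_n|\langle h,\psi_n\rangle|^2\le B\|h\|^2$ for all $h\in W$. A sequence in $\mathcal{H}$ is a Bessel sequence in $\mathcal{H}$ if the upper inequality holds for all $h\in\mathcal{H}$. For a bounded operator $S$ with closed range, $S^\dagger$ denotes its (bounded) Moore–Penrose inverse. *)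

theory Defs
  imports "HOL-Analysis.Analysis"
begin

text \<open>
  The scalar field is real or complex. Both cases are covered by a class of real normed fields
  with a conjugation. Since
  \<open>x + kconj x\<close> and \<open>x * kconj x\<close> are real, each element of such a field is a root of a real
  quadratic polynomial. Hence up to isomorphism the only models are the reals with the identity
  and the complex numbers with complex conjugation, each with the usual absolute value.
\<close>

class real_or_complex = real_normed_field +
  fixes kconj :: "'a \<Rightarrow> 'a"
  assumes kconj_add: "kconj (x + y) = kconj x + kconj y"
    and kconj_mult: "kconj (x * y) = kconj x * kconj y"
    and kconj_kconj: "kconj (kconj x) = x"
    and mult_kconj: "x * kconj x = (norm x)\<^sup>2 *\<^sub>R 1"

instantiation real :: real_or_complex
begin
definition kconj_real :: "real \<Rightarrow> real" where "kconj_real x = x"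
instance by standard (auto simp: kconj_real_def power2_eq_square)
end

instantiation complex :: real_or_complex
begin
definition kconj_complex :: "complex \<Rightarrow> complex" where "kconj_complex = cnj"
instance by standard (auto simp: kconj_complex_def scaleR_conv_of_real complex_norm_square simp flip: of_real_power)
end

text \<open>
  A Hilbert space over \<open>'k\<close>. Completeness and the norm topology come from the class \<open>banach\<close>. The
  last assumption says that the norm is the one induced by the inner product \<open>ip\<close>, which also
  gives positive definiteness. The inner product is linear in the first argument.
\<close>

locale hilbert_space = vector_space smul
  for smul :: "'k::real_or_complex \<Rightarrow> 'h::banach \<Rightarrow> 'h" +
  fixes ip :: "'h \<Rightarrow> 'h \<Rightarrow> 'k"
  assumes scale_of_real: "smul (of_real r) x = r *\<^sub>R x"
    and ip_add_left: "ip (x + y) z = ip x z + ip y z"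
    and ip_scale_left: "ip (smul c x) z = c * ip x z"
    and ip_commute: "ip y x = kconj (ip x y)"
    and ip_self: "ip x x = of_real ((norm x)\<^sup>2)"

lemma hilbert_space_real_inner:
  "hilbert_space scaleR (inner :: 'a::{real_inner,banach} \<Rightarrow> 'a \<Rightarrow> real)"
  by unfold_locales
    (auto simp: algebra_simps inner_commute kconj_real_def power2_norm_eq_inner)

lemma hilbert_space_complex:
  "hilbert_space (*) (\<lambda>x y :: complex. x * cnj y)"
  by unfold_locales
    (auto simp: algebra_simps kconj_complex_def scaleR_conv_of_real complex_norm_square
      simp flip: of_real_power)

definition orth_compl :: "('h \<Rightarrow> 'h \<Rightarrow> 'k::zero) \<Rightarrow> 'h set \<Rightarrow> 'h set"
  where "orth_compl ip W = {h. \<forall>w\<in>W. ip h w = 0}"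

definition ker :: "('h \<Rightarrow> 'g::zero) \<Rightarrow> 'h set"
  where "ker S = {h. S h = 0}"

text \<open>Summability is required explicitly because \<open>suminf\<close> of a divergent series is unspecified.\<close>

definition is_bessel :: "('h::real_normed_vector \<Rightarrow> 'h \<Rightarrow> 'k::real_normed_vector) \<Rightarrow> (nat \<Rightarrow> 'h) \<Rightarrow> bool"
  where "is_bessel ip \<psi> \<longleftrightarrow>
    (\<exists>B>0. \<forall>h. summable (\<lambda>n. (norm (ip h (\<psi> n)))\<^sup>2) \<and>
              (\<Sum>n. (norm (ip h (\<psi> n)))\<^sup>2) \<le> B * (norm h)\<^sup>2)"

definition is_frame_for ::
    "('h::real_normed_vector \<Rightarrow> 'h \<Rightarrow> 'k::real_normed_vector) \<Rightarrow> 'h set \<Rightarrow> (nat \<Rightarrow> 'h) \<Rightarrow> bool"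
  where "is_frame_for ip W \<psi> \<longleftrightarrow> range \<psi> \<subseteq> W \<and>
    (\<exists>A>0. \<exists>B>0. \<forall>h\<in>W. summable (\<lambda>n. (norm (ip h (\<psi> n)))\<^sup>2) \<and>
       A * (norm h)\<^sup>2 \<le> (\<Sum>n. (norm (ip h (\<psi> n)))\<^sup>2) \<and>
       (\<Sum>n. (norm (ip h (\<psi> n)))\<^sup>2) \<le> B * (norm h)\<^sup>2)"

definition frame_operator ::
    "('k \<Rightarrow> 'h::real_normed_vector \<Rightarrow> 'h) \<Rightarrow> ('h \<Rightarrow> 'h \<Rightarrow> 'k) \<Rightarrow> (nat \<Rightarrow> 'h) \<Rightarrow> 'h \<Rightarrow> 'h"
  where "frame_operator smul ip \<psi> h = (\<Sum>n. smul (ip h (\<psi> n)) (\<psi> n))"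

definition bounded_operator ::
    "('k::field \<Rightarrow> 'h::real_normed_vector \<Rightarrow> 'h) \<Rightarrow> ('h \<Rightarrow> 'h) \<Rightarrow> bool"
  where "bounded_operator smul S \<longleftrightarrow>
    Vector_Spaces.linear smul smul S \<and> (\<exists>M. \<forall>x. norm (S x) \<le> M * norm x)"

definition self_adjoint :: "('h \<Rightarrow> 'h \<Rightarrow> 'k) \<Rightarrow> ('h \<Rightarrow> 'h) \<Rightarrow> bool"
  where "self_adjoint ip T \<longleftrightarrow> (\<forall>x y. ip (T x) y = ip x (T y))"

text \<open>The four Penrose equations, for a bounded \<open>T\<close>.\<close>

definition is_mp_inverse ::
    "('k::field \<Rightarrow> 'h::real_normed_vector \<Rightarrow> 'h) \<Rightarrow> ('h \<Rightarrow> 'h \<Rightarrow> 'k) \<Rightarrow> ('h \<Rightarrow> 'h) \<Rightarrow> ('h \<Rightarrow> 'h) \<Rightarrow> bool"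
  where "is_mp_inverse smul ip S T \<longleftrightarrow> bounded_operator smul T \<and>
    S \<circ> T \<circ> S = S \<and> T \<circ> S \<circ> T = T \<and> self_adjoint ip (S \<circ> T) \<and> self_adjoint ip (T \<circ> S)"

text \<open>Meaningful only if exactly one Moore--Penrose inverse exists.\<close>

definition mp_inverse ::
    "('k::field \<Rightarrow> 'h::real_normed_vector \<Rightarrow> 'h) \<Rightarrow> ('h \<Rightarrow> 'h \<Rightarrow> 'k) \<Rightarrow> ('h \<Rightarrow> 'h) \<Rightarrow> ('h \<Rightarrow> 'h)"
  where "mp_inverse smul ip S = (THE T. is_mp_inverse smul ip S T)"

end

theory Submission
  imports Defs
begin

text \<open>
  On \<open>W\<close> the lower frame bound reads \<open>A * \<parallel>h\<parallel>\<^sup>2 \<le> \<langle>S h, h\<rangle>\<close>, so for \<open>w \<in> W\<close> and small \<open>t > 0\<close> the map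
  \<open>h \<mapsto> h - t * (S h - w)\<close> is a contraction of \<open>W\<close>, whose fixed point solves \<open>S h = w\<close>. Hence \<open>S\<close>
  restricts to a bijection of \<open>W\<close> with bounded inverse \<open>R\<close>. As \<open>S\<close> is self-adjoint with range \<open>W\<close>, the
  map \<open>P = R \<circ> S\<close> is the orthogonal projection onto \<open>W\<close>, with kernel \<open>ker S = W\<^sup>\<bottom>\<close>, and \<open>R \<circ> P\<close> solves
  the Penrose equations.
\<close>

section \<open>Conjugation on the scalar field\<close>

lemma kconj_zero [simp]: "kconj 0 = (0::'a::real_or_complex)"
  using kconj_add[of 0 "0::'a"] by simp

lemma norm_kconj [simp]: "norm (kconj x) = norm (x::'a::real_or_complex)"
proof (cases "x = 0")
  case False
  have "norm x * norm (kconj x) = norm x * norm x"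
    using arg_cong[OF mult_kconj[of x], of norm] by (simp add: norm_mult power2_eq_square)
  with False show ?thesis by simp
qed simp

text \<open>Conjugation is not assumed to fix the reals; this follows by cancelling \<open>r\<close>
  in \<open>r * kconj r = r * r\<close>, an instance of \<open>mult_kconj\<close>.\<close>

lemma kconj_of_real [simp]: "kconj (of_real r) = (of_real r :: 'a::real_or_complex)"
proof (cases "r = 0")
  case False
  have "(of_real r :: 'a) * kconj (of_real r) = of_real r * of_real r"
    using mult_kconj[of "of_real r :: 'a"]
    by (simp add: power2_eq_square scaleR_conv_of_real)
  with False show ?thesis by simp
qed simp

lemma mult_kconj_of_real: "x * kconj x = (of_real ((norm x)\<^sup>2) :: 'a::real_or_complex)"
  by (simp add: mult_kconj scaleR_conv_of_real)

section \<open>Inner product geometry and uniqueness of Moore-Penrose inverses\<close>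

context hilbert_space
begin

lemma ip_scaleR_left: "ip (r *\<^sub>R x) z = of_real r * ip x z"
  by (metis scale_of_real ip_scale_left)

lemma ip_zero_left [simp]: "ip 0 z = 0"
  using ip_scaleR_left[of 0 0 z] by simp

lemma ip_minus_left: "ip (- x) z = - ip x z"
  using ip_scaleR_left[of "-1" x z] by simp

lemma ip_diff_left: "ip (x - y) z = ip x z - ip y z"
  using ip_add_left[of x "- y" z] by (simp add: ip_minus_left)

lemma ip_add_right: "ip x (y + z) = ip x y + ip x z"
  by (metis ip_add_left ip_commute kconj_add)

lemma ip_scale_right: "ip x (smul c y) = kconj c * ip x y"
  by (metis ip_commute ip_scale_left kconj_mult)

lemma ip_scaleR_right: "ip x (r *\<^sub>R y) = of_real r * ip x y"
  by (metis scale_of_real ip_scale_right kconj_of_real)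

lemma ip_zero_right [simp]: "ip x 0 = 0"
  using ip_scaleR_right[of x 0 0] by simp

lemma ip_diff_right: "ip x (y - z) = ip x y - ip x z"
  by (metis add_diff_cancel diff_add_cancel ip_add_right)

lemma ip_eq_0_commute: "ip x y = 0 \<longleftrightarrow> ip y x = 0"
  by (metis ip_commute kconj_zero)

lemma ip_sum_left: "ip (sum f F) z = (\<Sum>n\<in>F. ip (f n) z)"
  by (induction F rule: infinite_finite_induct) (auto simp: ip_add_left)

lemma ip_self_eq_0_iff: "ip x x = 0 \<longleftrightarrow> x = 0"
  by (simp add: ip_self)

lemma eqI_ip: "x = y" if "\<And>z. ip x z = ip y z"
  using that[of "x - y"] ip_self_eq_0_iff[of "x - y"] by (simp add: ip_diff_left)

lemma norm_ip_commute: "norm (ip x y) = norm (ip y x)"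
  by (metis ip_commute norm_kconj)

lemma norm_smul: "norm (smul c x) = norm c * norm x"
proof -
  \<comment> \<open>Identities between norms are proved in the scalar field, where
    \<open>ip_self\<close> turns squares into inner products that expand, and are pulled back along
    the injective \<open>of_real\<close>.\<close>
  have "of_real ((norm (smul c x))\<^sup>2) = (c * kconj c) * ip x x"
    by (simp only: ip_self[symmetric] ip_scale_left ip_scale_right ac_simps)
  also have "\<dots> = of_real ((norm c * norm x)\<^sup>2)"
    by (simp add: mult_kconj_of_real ip_self power_mult_distrib)
  finally show ?thesis
    unfolding of_real_eq_iff by (rule power2_eq_imp_eq) auto
qed

lemma pythagoras: "(norm (x + y))\<^sup>2 = (norm x)\<^sup>2 + (norm y)\<^sup>2" if "ip x y = 0"
proof -
  have "(of_real ((norm (x + y))\<^sup>2) :: 'k) = of_real ((norm x)\<^sup>2 + (norm y)\<^sup>2)"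
    using that ip_eq_0_commute[of x y]
    by (simp only: ip_self[symmetric] ip_add_left ip_add_right of_real_add) simp
  then show ?thesis unfolding of_real_eq_iff .
qed

lemma Cauchy_Schwarz: "norm (ip x y) \<le> norm x * norm y"
proof (cases "y = 0")
  case False
  \<comment> \<open>\<open>smul c y\<close> is the orthogonal projection of \<open>x\<close> onto
    the line through \<open>y\<close>.\<close>
  define c where "c = ip x y / of_real ((norm y)\<^sup>2)"
  have "ip (x - smul c y) (smul c y) = 0"
    using False by (simp add: c_def ip_diff_left ip_scale_left ip_scale_right ip_self)
  from pythagoras[OF this] have "(norm c * norm y)\<^sup>2 \<le> (norm x)\<^sup>2"
    by (simp add: norm_smul)
  then have "norm c * norm y \<le> norm x"
    by (rule power2_le_imp_le) simp
  moreover have "norm c = norm (ip x y) / (norm y)\<^sup>2"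
    by (simp add: c_def norm_divide norm_power)
  ultimately show ?thesis
    using False by (simp add: field_simps power2_eq_square)
qed simp

lemma bounded_linear_ip_left: "bounded_linear (\<lambda>x. ip x z)"
  by (rule bounded_linear_intro[where K = "norm z"])
    (simp_all add: ip_add_left ip_scaleR_left scaleR_conv_of_real Cauchy_Schwarz)

lemma bounded_operatorI:
  assumes "\<And>x y. S (x + y) = S x + S y" "\<And>c x. S (smul c x) = smul c (S x)"
    and "\<And>x. norm (S x) \<le> M * norm x"
  shows "bounded_operator smul S"
  unfolding bounded_operator_def
proof
  show "Vector_Spaces.linear smul smul S"
    by unfold_locales (simp_all add: assms scale_right_distrib scale_left_distrib)
qed (use assms in blast)

text \<open>By the Penrose equations \<open>S \<circ> T\<close> and \<open>S \<circ> U\<close> are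
  symmetric projections with the same range, hence equal; likewise \<open>T \<circ> S\<close> and
  \<open>U \<circ> S\<close> are symmetric projections with the same kernel. Then
  \<open>T = T \<circ> S \<circ> T = U \<circ> S \<circ> U = U\<close>.\<close>

lemma mp_inverse_unique:
  assumes "is_mp_inverse smul ip S T" "is_mp_inverse smul ip S U"
  shows "T = U"
proof -
  have T: "S (T (S x)) = S x" "T (S (T x)) = T x" "ip (S (T x)) y = ip x (S (T y))"
    "ip (T (S x)) y = ip x (T (S y))"
    and U: "S (U (S x)) = S x" "U (S (U x)) = U x" "ip (S (U x)) y = ip x (S (U y))"
    "ip (U (S x)) y = ip x (U (S y))" for x y
    using assms by (auto simp: is_mp_inverse_def self_adjoint_def fun_eq_iff)
  have ST: "S (T x) = S (U x)" for x
  proof (rule eqI_ip)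
    fix y
    have "ip (S (T x)) y = ip (S (U (S (T x)))) y" by (simp add: U)
    also have "\<dots> = ip x (S (T (S (U y))))" by (simp only: T(3) U(3))
    also have "\<dots> = ip (S (U x)) y" by (simp only: T(1) U(3))
    finally show "ip (S (T x)) y = ip (S (U x)) y" .
  qed
  have TS: "T (S x) = U (S x)" for x
  proof (rule eqI_ip)
    fix y
    have "ip (T (S x)) y = ip (T (S (U (S x)))) y" by (simp add: U)
    also have "\<dots> = ip x (U (S (T (S y))))" by (simp only: T(4) U(4))
    also have "\<dots> = ip (U (S x)) y" by (simp only: T(1) U(4))
    finally show "ip (T (S x)) y = ip (U (S x)) y" .
  qed
  show ?thesis
  proof
    fix x
    have "T x = T (S (T x))" by (simp add: T)
    also have "\<dots> = U (S (U x))" by (simp only: ST TS)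
    finally show "T x = U x" by (simp add: U)
  qed
qed

end

section \<open>Synthesis and Bessel bounds\<close>

locale subspace_frame = hilbert_space smul ip
  for smul :: "'k::real_or_complex \<Rightarrow> 'h::banach \<Rightarrow> 'h" and ip :: "'h \<Rightarrow> 'h \<Rightarrow> 'k" +
  fixes W :: "'h set" and \<psi> :: "nat \<Rightarrow> 'h" and A B :: real
  assumes subspace_W: "subspace W" and closed_W: "closed W" and \<psi>_in_W: "\<psi> n \<in> W"
    and A_pos: "0 < A" and A_le_B: "A \<le> B"
    and summable_on_W: "h \<in> W \<Longrightarrow> summable (\<lambda>n. (norm (ip h (\<psi> n)))\<^sup>2)"
    and lower_bound: "h \<in> W \<Longrightarrow> A * (norm h)\<^sup>2 \<le> (\<Sum>n. (norm (ip h (\<psi> n)))\<^sup>2)"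
    and upper_bound_on_W: "h \<in> W \<Longrightarrow> (\<Sum>n. (norm (ip h (\<psi> n)))\<^sup>2) \<le> B * (norm h)\<^sup>2"
begin

abbreviation "S \<equiv> frame_operator smul ip \<psi>"

lemma B_pos: "0 < B"
  using A_pos A_le_B by simp

lemma scaleR_in_W: "x \<in> W \<Longrightarrow> r *\<^sub>R x \<in> W"
  using subspace_scale[OF subspace_W, of x "of_real r"] by (simp add: scale_of_real)

text \<open>Expanding one factor of \<open>ip v v\<close> and applying Cauchy-Schwarz to the finite
  sum leaves the coefficients of \<open>v\<close> itself. Since \<open>v\<close> lies in
  \<open>W\<close>, the upper frame bound applies to it, and a factor of the squared norm of
  \<open>v\<close> cancels.\<close>

lemma synthesis_bound_finite:
  assumes F: "finite F"
  shows "(norm (\<Sum>n\<in>F. smul (c n) (\<psi> n)))\<^sup>2 \<le> B * (\<Sum>n\<in>F. (norm (c n))\<^sup>2)"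
proof -
  define v where "v = (\<Sum>n\<in>F. smul (c n) (\<psi> n))"
  have v: "v \<in> W"
    unfolding v_def by (intro subspace_sum subspace_scale subspace_W \<psi>_in_W)
  have "(norm v)\<^sup>2 = norm (ip v v)" by (simp add: ip_self norm_power)
  also have "\<dots> = norm (\<Sum>n\<in>F. c n * ip (\<psi> n) v)"
    by (subst v_def) (simp add: ip_sum_left ip_scale_left)
  also have "\<dots> \<le> (\<Sum>n\<in>F. norm (c n) * norm (ip v (\<psi> n)))"
    by (rule sum_norm_le) (simp add: norm_mult norm_ip_commute[of v])
  finally have "((norm v)\<^sup>2)\<^sup>2 \<le> (\<Sum>n\<in>F. norm (c n) * norm (ip v (\<psi> n)))\<^sup>2"
    by (rule power_mono) simp
  also have "\<dots> \<le> (\<Sum>n\<in>F. (norm (c n))\<^sup>2) * (\<Sum>n\<in>F. (norm (ip v (\<psi> n)))\<^sup>2)"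
    by (rule Cauchy_Schwarz_ineq_sum)
  also have "\<dots> \<le> (\<Sum>n\<in>F. (norm (c n))\<^sup>2) * (B * (norm v)\<^sup>2)"
  proof (rule mult_left_mono)
    show "(\<Sum>n\<in>F. (norm (ip v (\<psi> n)))\<^sup>2) \<le> B * (norm v)\<^sup>2"
      using sum_le_suminf[OF summable_on_W[OF v] F] upper_bound_on_W[OF v] by force
  qed (simp add: sum_nonneg)
  finally have "(norm v)\<^sup>2 * (norm v)\<^sup>2 \<le> (norm v)\<^sup>2 * (B * (\<Sum>n\<in>F. (norm (c n))\<^sup>2))"
    by (simp add: power2_eq_square algebra_simps)
  then show ?thesis
    unfolding v_def[symmetric] mult_le_cancel_left
    using B_pos by (cases "v = 0") (simp_all add: sum_nonneg)
qed

text \<open>Duality transfers the upper bound from \<open>W\<close> to the whole space without the projection theorem.\<close>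

lemma bessel_bound_finite:
  assumes F: "finite F"
  shows "(\<Sum>n\<in>F. (norm (ip h (\<psi> n)))\<^sup>2) \<le> B * (norm h)\<^sup>2"
proof -
  define s where "s = (\<Sum>n\<in>F. (norm (ip h (\<psi> n)))\<^sup>2)"
  \<comment> \<open>With the coefficients of \<open>h\<close> themselves as weights, pairing
    \<open>v\<close> with \<open>h\<close> gives exactly \<open>s\<close>, while the synthesis bound
    controls the norm of \<open>v\<close> by \<open>s\<close> again; one factor \<open>s\<close>
    then cancels.\<close>
  define v where "v = (\<Sum>n\<in>F. smul (ip h (\<psi> n)) (\<psi> n))"
  have s: "0 \<le> s" by (simp add: s_def sum_nonneg)
  have "ip v h = (\<Sum>n\<in>F. ip h (\<psi> n) * kconj (ip h (\<psi> n)))"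
    by (simp add: v_def ip_sum_left ip_scale_left flip: ip_commute)
  also have "\<dots> = of_real s"
    by (simp add: s_def mult_kconj_of_real)
  finally have "s = norm (ip v h)" using s by simp
  then have "s \<le> norm v * norm h" by (simp add: Cauchy_Schwarz)
  then have "s\<^sup>2 \<le> (norm v * norm h)\<^sup>2" using s by (rule power_mono)
  also have "\<dots> \<le> B * s * (norm h)\<^sup>2"
    unfolding power_mult_distrib v_def s_def
    by (intro mult_right_mono synthesis_bound_finite F) simp
  finally have "s * s \<le> s * (B * (norm h)\<^sup>2)"
    by (simp add: power2_eq_square algebra_simps)
  then show ?thesis
    unfolding s_def[symmetric]
    using s B_pos by (cases "s = 0") simp_all
qed

lemma summable_coeffs: "summable (\<lambda>n. (norm (ip h (\<psi> n)))\<^sup>2)"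
  by (rule summableI_nonneg_bounded[where x = "B * (norm h)\<^sup>2"]) (simp_all add: bessel_bound_finite)

lemma bessel_bound: "(\<Sum>n. (norm (ip h (\<psi> n)))\<^sup>2) \<le> B * (norm h)\<^sup>2"
  by (rule suminf_le_const[OF summable_coeffs]) (simp add: bessel_bound_finite)

lemma is_bessel: "is_bessel ip \<psi>"
  unfolding is_bessel_def using B_pos summable_coeffs bessel_bound by blast

section \<open>The frame operator: convergence, boundedness, self-adjointness\<close>

lemma summable_frame_series: "summable (\<lambda>n. smul (ip h (\<psi> n)) (\<psi> n))"
  unfolding summable_Cauchy
proof (intro allI impI)
  fix e :: real
  assume e: "0 < e"
  \<comment> \<open>The synthesis bound makes the squared norm of a block of the series at most
    \<open>B\<close> times the same block of squared coefficients, so those blocks must be below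
    \<open>e\<^sup>2 / B\<close>.\<close>
  with B_pos have "0 < e\<^sup>2 / B" by simp
  with summable_coeffs[of h] obtain N where
    N: "\<And>m n. m \<ge> N \<Longrightarrow> norm (\<Sum>k = m..<n. (norm (ip h (\<psi> k)))\<^sup>2) < e\<^sup>2 / B"
    unfolding summable_Cauchy by blast
  have "norm (\<Sum>k = m..<n. smul (ip h (\<psi> k)) (\<psi> k)) < e" if "m \<ge> N" for m n
  proof -
    have "B * (\<Sum>k = m..<n. (norm (ip h (\<psi> k)))\<^sup>2) < e\<^sup>2"
      using N[OF that, of n] B_pos by (simp add: sum_nonneg field_simps)
    then have "(norm (\<Sum>k = m..<n. smul (ip h (\<psi> k)) (\<psi> k)))\<^sup>2 < e\<^sup>2"
      using synthesis_bound_finite[of "{m..<n}" "\<lambda>k. ip h (\<psi> k)"] by simp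
    then show ?thesis
      using e by (simp add: power_less_imp_less_base)
  qed
  then show "\<exists>N. \<forall>m\<ge>N. \<forall>n. norm (\<Sum>k = m..<n. smul (ip h (\<psi> k)) (\<psi> k)) < e"
    by blast
qed

lemma S_sums: "(\<lambda>n. smul (ip h (\<psi> n)) (\<psi> n)) sums S h"
  unfolding frame_operator_def using summable_frame_series by (rule summable_sums)

lemma S_in_W: "S h \<in> W"
  by (rule closed_sequentially[OF closed_W _ S_sums[unfolded sums_def]])
    (intro subspace_sum subspace_scale subspace_W \<psi>_in_W)

lemma S_ip_sums: "(\<lambda>n. ip h (\<psi> n) * ip (\<psi> n) g) sums ip (S h) g"
  using bounded_linear.sums[OF bounded_linear_ip_left S_sums] by (simp add: ip_scale_left)

text \<open>Turns the frame bounds into statements about the quadratic form of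
  \<open>S\<close>.\<close>

lemma ip_S_self: "ip (S h) h = of_real (\<Sum>n. (norm (ip h (\<psi> n)))\<^sup>2)"
proof -
  have "(\<lambda>n. of_real ((norm (ip h (\<psi> n)))\<^sup>2)) sums ip (S h) h"
    using S_ip_sums[of h h] by (simp only: mult_kconj_of_real[symmetric] ip_commute[symmetric])
  moreover have "(\<lambda>n. (of_real ((norm (ip h (\<psi> n)))\<^sup>2) :: 'k)) sums of_real (\<Sum>n. (norm (ip h (\<psi> n)))\<^sup>2)"
    using sums_of_real summable_sums summable_coeffs by blast
  ultimately show ?thesis by (rule sums_unique2)
qed

lemma S_add: "S (x + y) = S x + S y"
proof (rule sums_unique2[OF S_sums])
  show "(\<lambda>n. smul (ip (x + y) (\<psi> n)) (\<psi> n)) sums (S x + S y)"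
    using sums_add[OF S_sums S_sums] by (simp add: ip_add_left scale_left_distrib)
qed

text \<open>On partial sums one factor \<open>B\<close> comes from synthesis and one from the Bessel
  bound; the estimate survives the limit.\<close>

lemma S_norm_sq: "(norm (S h))\<^sup>2 \<le> B\<^sup>2 * (norm h)\<^sup>2"
proof (rule LIMSEQ_le_const2)
  show "(\<lambda>n. (norm (\<Sum>k<n. smul (ip h (\<psi> k)) (\<psi> k)))\<^sup>2) \<longlonglongrightarrow> (norm (S h))\<^sup>2"
    using S_sums[unfolded sums_def] by (intro tendsto_intros)
  have "(norm (\<Sum>k<n. smul (ip h (\<psi> k)) (\<psi> k)))\<^sup>2 \<le> B\<^sup>2 * (norm h)\<^sup>2" for n
  proof -
    have "(norm (\<Sum>k<n. smul (ip h (\<psi> k)) (\<psi> k)))\<^sup>2 \<le> B * (\<Sum>k<n. (norm (ip h (\<psi> k)))\<^sup>2)"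
      by (rule synthesis_bound_finite) simp
    also have "\<dots> \<le> B * (B * (norm h)\<^sup>2)"
      using B_pos by (intro mult_left_mono bessel_bound_finite) simp_all
    finally show ?thesis by (simp add: power2_eq_square mult.assoc)
  qed
  then show "\<exists>N. \<forall>n\<ge>N. (norm (\<Sum>k<n. smul (ip h (\<psi> k)) (\<psi> k)))\<^sup>2 \<le> B\<^sup>2 * (norm h)\<^sup>2"
    by blast
qed

lemma S_norm: "norm (S h) \<le> B * norm h"
  by (rule power2_le_imp_le) (use S_norm_sq B_pos in \<open>simp_all add: power_mult_distrib\<close>)

lemma S_smul: "S (smul c x) = smul c (S x)"
proof (rule sums_unique2[OF S_sums])
  have "bounded_linear (smul c)"
    by (rule bounded_linear_intro[where K = "norm c"])
      (simp_all add: scale_right_distrib norm_smul mult.commute scale_left_commute flip: scale_of_real)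
  from bounded_linear.sums[OF this S_sums]
  show "(\<lambda>n. smul (ip (smul c x) (\<psi> n)) (\<psi> n)) sums smul c (S x)"
    by (simp add: ip_scale_left)
qed

lemma S_scaleR: "S (r *\<^sub>R x) = r *\<^sub>R S x"
  by (metis S_smul scale_of_real)

text \<open>Conjugation is bounded and real-linear, so it passes through the series for
  \<open>ip (S y) x\<close>; the conjugated terms are those of \<open>ip (S x) y\<close>.\<close>

lemma S_self_adjoint: "ip (S x) y = ip x (S y)"
proof -
  have "bounded_linear (kconj :: 'k \<Rightarrow> 'k)"
    by (rule bounded_linear_intro[where K = 1])
      (simp_all add: kconj_add kconj_mult scaleR_conv_of_real)
  from bounded_linear.sums[OF this S_ip_sums[of y x]]
  have "(\<lambda>n. kconj (ip y (\<psi> n)) * kconj (ip (\<psi> n) x)) sums kconj (ip (S y) x)"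
    by (simp add: kconj_mult)
  then have "(\<lambda>n. ip x (\<psi> n) * ip (\<psi> n) y) sums ip x (S y)"
    by (simp add: mult.commute flip: ip_commute)
  then show ?thesis
    using S_ip_sums sums_unique2 by blast
qed

lemma bounded_operator_S: "bounded_operator smul S"
  using S_add S_smul S_norm by (rule bounded_operatorI)

section \<open>Bijectivity on \<open>W\<close>, and the range and kernel of the frame
  operator\<close>

lemma S_diff: "S (x - y) = S x - S y"
  using S_add[of "x - y" y] by simp

text \<open>Cauchy-Schwarz turns the lower frame bound into boundedness below, which yields both
  injectivity on \<open>W\<close> and the bound on the inverse.\<close>

lemma S_lower: "A * norm h \<le> norm (S h)" if h: "h \<in> W"
proof (cases "h = 0")
  case False
  have "A * (norm h)\<^sup>2 \<le> norm (ip (S h) h)"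
    using lower_bound[OF h] by (simp add: ip_S_self)
  also have "\<dots> \<le> norm (S h) * norm h" by (rule Cauchy_Schwarz)
  finally have "(A * norm h) * norm h \<le> norm (S h) * norm h"
    by (simp add: power2_eq_square mult.assoc)
  with False show ?thesis by simp
qed simp

text \<open>The squared norm is at most \<open>1 - 2 * t * A + t\<^sup>2 * B\<^sup>2\<close> times
  that of \<open>h\<close>. The step \<open>t = A / B\<^sup>2\<close> minimises this quadratic, with
  minimum \<open>1 - A\<^sup>2 / B\<^sup>2\<close>.\<close>

lemma contraction_step:
  assumes h: "h \<in> W"
  shows "norm (h - (A / B\<^sup>2) *\<^sub>R S h) \<le> sqrt (1 - A\<^sup>2 / B\<^sup>2) * norm h"
proof -
  define t where "t = A / B\<^sup>2"
  define q where "q = (\<Sum>n. (norm (ip h (\<psi> n)))\<^sup>2)"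
  have q: "A * (norm h)\<^sup>2 \<le> q" using lower_bound[OF h] by (simp add: q_def)
  have t: "0 \<le> t" using A_pos by (simp add: t_def)
  have ip1: "ip (S h) h = of_real q" by (simp add: ip_S_self q_def)
  then have ip2: "ip h (S h) = of_real q" by (metis ip_commute kconj_of_real)
  have "(of_real ((norm (h - t *\<^sub>R S h))\<^sup>2) :: 'k)
      = of_real ((norm h)\<^sup>2 - 2 * t * q + t\<^sup>2 * (norm (S h))\<^sup>2)"
    by (simp only: ip_self[symmetric] ip_diff_left ip_diff_right ip_scaleR_left ip_scaleR_right ip1 ip2)
      (simp add: ip_self power2_eq_square algebra_simps)
  then have "(norm (h - t *\<^sub>R S h))\<^sup>2 = (norm h)\<^sup>2 - 2 * t * q + t\<^sup>2 * (norm (S h))\<^sup>2"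
    unfolding of_real_eq_iff .
  also have "\<dots> \<le> (norm h)\<^sup>2 - 2 * t * (A * (norm h)\<^sup>2) + t\<^sup>2 * (B\<^sup>2 * (norm h)\<^sup>2)"
    using t q S_norm_sq[of h] by (intro add_mono diff_mono mult_left_mono) auto
  also have "\<dots> = (1 - A\<^sup>2 / B\<^sup>2) * (norm h)\<^sup>2"
    using B_pos by (simp add: t_def field_simps power2_eq_square)
  finally have "sqrt ((norm (h - t *\<^sub>R S h))\<^sup>2) \<le> sqrt ((1 - A\<^sup>2 / B\<^sup>2) * (norm h)\<^sup>2)"
    by (rule real_sqrt_le_mono)
  then show ?thesis by (simp add: real_sqrt_mult t_def)
qed

lemma inj_on_S: "inj_on S W"
proof (rule inj_onI)
  fix x y
  assume "x \<in> W" "y \<in> W" "S x = S y"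
  then have "A * norm (x - y) \<le> 0"
    using S_lower[of "x - y"] subspace_diff[OF subspace_W] by (simp add: S_diff)
  with A_pos show "x = y" by (simp add: mult_le_0_iff)
qed

lemma S_image_W: "S ` W = W"
proof
  show "S ` W \<subseteq> W" using S_in_W by blast
  show "W \<subseteq> S ` W"
  proof
    fix w
    assume w: "w \<in> W"
    define t where "t = A / B\<^sup>2"
    \<comment> \<open>The term in \<open>w\<close> cancels in \<open>f x - f y\<close>, so the
      contraction estimate is needed only for the linear part, at \<open>x - y\<close>.\<close>
    define f where "f h = h - t *\<^sub>R (S h - w)" for h
    \<comment> \<open>Positivity makes the contraction constant less than \<open>1\<close>; the
      upper bound, which rests on \<open>A \<le> B\<close>, makes it nonnegative.\<close>
    have ratio: "0 < A\<^sup>2 / B\<^sup>2" "A\<^sup>2 / B\<^sup>2 \<le> 1"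
      using A_pos B_pos A_le_B by (simp_all add: power_mono)
    have "\<exists>!h\<in>W. f h = h"
    proof (rule Banach_fix[where c = "sqrt (1 - A\<^sup>2 / B\<^sup>2)"])
      show "complete W" using closed_W by (simp add: complete_eq_closed)
      show "W \<noteq> {}" using w by blast
      show "f ` W \<subseteq> W"
        unfolding f_def using w by (auto intro!: subspace_diff subspace_W scaleR_in_W S_in_W)
      fix x y
      assume "x \<in> W" "y \<in> W"
      then have "x - y \<in> W" by (rule subspace_diff[OF subspace_W])
      moreover have "f x - f y = (x - y) - t *\<^sub>R S (x - y)"
        by (simp add: f_def S_diff algebra_simps)
      ultimately show "dist (f x) (f y) \<le> sqrt (1 - A\<^sup>2 / B\<^sup>2) * dist x y"
        using contraction_step by (simp add: dist_norm t_def)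
    qed (use ratio in auto)
    then obtain h where "h \<in> W" "f h = h" by blast
    moreover have "t \<noteq> 0" using A_pos B_pos by (simp add: t_def)
    ultimately show "w \<in> S ` W" by (auto simp: f_def)
  qed
qed

lemma range_S: "range S = W"
  using S_image_W S_in_W by blast

text \<open>Both inclusions move \<open>S\<close> across the inner product: each element of
  \<open>W\<close> is some \<open>S u\<close>, and conversely \<open>h\<close> is tested against
  \<open>S (S h)\<close>, which lies in \<open>W\<close>.\<close>

lemma ker_S: "ker S = orth_compl ip W"
proof (intro set_eqI iffI)
  fix h
  assume h: "h \<in> ker S"
  show "h \<in> orth_compl ip W"
    unfolding orth_compl_def
  proof (intro CollectI ballI)
    fix w
    assume "w \<in> W"
    then obtain u where "w = S u" using S_image_W by blast
    then have "ip h w = ip (S h) u" by (simp add: S_self_adjoint)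
    with h show "ip h w = 0" by (simp add: ker_def)
  qed
next
  fix h
  assume "h \<in> orth_compl ip W"
  then have "ip h (S (S h)) = 0" using S_in_W by (simp add: orth_compl_def)
  then have "ip (S h) (S h) = 0" by (simp add: S_self_adjoint)
  then show "h \<in> ker S" by (simp add: ker_def ip_self_eq_0_iff)
qed

section \<open>The inverse on \<open>W\<close> and the Moore-Penrose inverse\<close>

definition R :: "'h \<Rightarrow> 'h" where "R = inv_into W S"

lemma R_in_W: "w \<in> W \<Longrightarrow> R w \<in> W"
  unfolding R_def by (rule inv_into_into) (simp add: S_image_W)

lemma S_R: "w \<in> W \<Longrightarrow> S (R w) = w"
  unfolding R_def by (rule f_inv_into_f) (simp add: S_image_W)

lemma R_S: "w \<in> W \<Longrightarrow> R (S w) = w"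
  unfolding R_def by (rule inv_into_f_f[OF inj_on_S])

lemma R_eqI: "R w = v" if "v \<in> W" "S v = w"
  using R_S that by blast

lemma R_add: "R (v + w) = R v + R w" if "v \<in> W" "w \<in> W"
  by (rule R_eqI) (simp_all only: S_add S_R R_in_W subspace_add[OF subspace_W] that)

lemma R_smul: "R (smul c w) = smul c (R w)" if "w \<in> W"
  by (rule R_eqI) (simp_all only: S_smul S_R R_in_W subspace_scale[OF subspace_W] that)

lemma R_norm: "norm (R w) \<le> norm w / A" if "w \<in> W"
  using S_lower[OF R_in_W[OF that]] A_pos that by (simp add: S_R field_simps)

text \<open>\<open>x - R (S x)\<close> is killed by \<open>S\<close>, hence orthogonal to
  \<open>W\<close>. So \<open>ip x (R (S y))\<close> equals \<open>ip (R (S x)) (R (S y))\<close>,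
  an expression that treats \<open>x\<close> and \<open>y\<close> alike.\<close>

lemma R_S_self_adjoint: "ip (R (S x)) y = ip x (R (S y))"
proof -
  have proj: "ip x (R (S y)) = ip (R (S x)) (R (S y))" for x y
  proof -
    have "x - R (S x) \<in> orth_compl ip W"
      unfolding ker_S[symmetric] by (simp add: ker_def S_diff S_R S_in_W)
    then have "ip (x - R (S x)) (R (S y)) = 0"
      using R_in_W[OF S_in_W] by (simp only: orth_compl_def mem_Collect_eq)
    then show ?thesis by (simp only: ip_diff_left right_minus_eq)
  qed
  have "ip (R (S x)) y = kconj (ip y (R (S x)))" by (rule ip_commute)
  also have "\<dots> = ip (R (S x)) (R (S y))"
    by (simp only: proj[of y x] ip_commute[symmetric])
  finally show ?thesis by (simp only: proj[of x y])
qed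

text \<open>The candidate inverse: project onto \<open>W\<close> by \<open>R \<circ> S\<close>, then
  invert \<open>S\<close> there. Both uses of \<open>R\<close> are at points of \<open>W\<close>, so
  its unspecified values elsewhere never enter.\<close>

definition D :: "'h \<Rightarrow> 'h" where "D x = R (R (S x))"

lemma D_in_W: "D x \<in> W"
  by (simp add: D_def R_in_W S_in_W)

text \<open>Together with \<open>D_S\<close> this identifies both compositions with the same
  projection, so one symmetry lemma serves both self-adjointness equations.\<close>

lemma S_D: "S (D x) = R (S x)"
  by (simp add: D_def S_R R_in_W S_in_W)

lemma D_S: "D (S x) = R (S x)"
  by (simp add: D_def R_S S_in_W)

lemma mp_D: "is_mp_inverse smul ip S D"
  unfolding is_mp_inverse_def
proof (intro conjI)
  show "bounded_operator smul D"
  proof (rule bounded_operatorI)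
    fix x
    have "norm (D x) \<le> norm (R (S x)) / A"
      unfolding D_def by (intro R_norm R_in_W S_in_W)
    also have "\<dots> \<le> norm (S x) / A / A"
      using A_pos by (intro divide_right_mono R_norm S_in_W) simp
    also have "\<dots> \<le> (B * norm x) / A / A"
      using S_norm A_pos by (intro divide_right_mono) auto
    finally show "norm (D x) \<le> (B / A / A) * norm x" by simp
  next
    show "D (x + y) = D x + D y" for x y
      by (simp only: D_def S_add R_add S_in_W R_in_W)
    show "D (smul c x) = smul c (D x)" for c x
      by (simp only: D_def S_smul R_smul S_in_W R_in_W)
  qed
  show "S \<circ> D \<circ> S = S" by (simp add: fun_eq_iff S_D R_S S_in_W)
  show "D \<circ> S \<circ> D = D" by (simp add: fun_eq_iff D_S R_S D_in_W)
  show "self_adjoint ip (S \<circ> D)" by (simp add: self_adjoint_def S_D R_S_self_adjoint)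
  show "self_adjoint ip (D \<circ> S)" by (simp add: self_adjoint_def D_S R_S_self_adjoint)
qed

lemma ex1_mp_inverse: "\<exists>!T. is_mp_inverse smul ip S T"
  using mp_D mp_inverse_unique by blast

lemma mp_inverse_eq: "mp_inverse smul ip S = D"
  unfolding mp_inverse_def by (rule the_equality) (use mp_D mp_inverse_unique in auto)

lemma range_D: "range D = W"
proof
  show "W \<subseteq> range D"
  proof
    fix w
    assume "w \<in> W"
    then have "w = D (S w)" by (simp add: D_S R_S)
    then show "w \<in> range D" by blast
  qed
qed (use D_in_W in blast)

lemma ker_D: "ker D = ker S"
proof -
  have zero: "S 0 = 0" using S_scaleR[of 0 0] by simp
  then have "R 0 = 0" using R_S[of 0] subspace_0[OF subspace_W] by simp
  then have "D x = 0" if "S x = 0" for x using that by (simp add: D_def)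
  \<comment> \<open>Applying \<open>S\<close> to \<open>D x = 0\<close> gives
    \<open>R (S x) = 0\<close>; applying it once more recovers \<open>S x = 0\<close>.\<close>
  moreover have "S x = 0" if "D x = 0" for x
    using that S_D[of x] S_R[OF S_in_W, of x] zero by simp
  ultimately show ?thesis by (auto simp: ker_def)
qed

end

theorem proposition4p1:
  fixes smul :: "'k::real_or_complex \<Rightarrow> 'h::banach \<Rightarrow> 'h"
    and ip :: "'h \<Rightarrow> 'h \<Rightarrow> 'k"
    and W :: "'h set"
    and \<psi> :: "nat \<Rightarrow> 'h"
  assumes "hilbert_space smul ip"
    and "separable_space (euclidean :: 'h topology)"
    and "module.subspace smul W"
    and "closed W"
    and "is_frame_for ip W \<psi>"
  shows "is_bessel ip \<psi> \<and>
    (\<forall>h. summable (\<lambda>n. smul (ip h (\<psi> n)) (\<psi> n))) \<and>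
    (let S = frame_operator smul ip \<psi>; S_dag = mp_inverse smul ip S in
      bounded_operator smul S \<and>
      (range S = W \<and> (\<exists>!T. is_mp_inverse smul ip S T) \<and> range S_dag = W) \<and>
      (ker S = orth_compl ip W \<and> orth_compl ip W = ker S_dag))"
proof -
  interpret hilbert_space smul ip by fact
  obtain A B where AB: "0 < A"
    "\<forall>h\<in>W. summable (\<lambda>n. (norm (ip h (\<psi> n)))\<^sup>2) \<and>
      A * (norm h)\<^sup>2 \<le> (\<Sum>n. (norm (ip h (\<psi> n)))\<^sup>2) \<and>
      (\<Sum>n. (norm (ip h (\<psi> n)))\<^sup>2) \<le> B * (norm h)\<^sup>2"
    and \<psi>: "range \<psi> \<subseteq> W"
    using assms(5) unfolding is_frame_for_def by (elim conjE exE)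
  \<comment> \<open>\<open>A \<le> B\<close> can fail when \<open>W = {0}\<close>.\<close>
  have max_bound: "B * (norm h)\<^sup>2 \<le> max A B * (norm h)\<^sup>2" for h :: 'h
    by (rule mult_right_mono) simp_all
  interpret subspace_frame smul ip W \<psi> A "max A B"
  proof
    fix h
    assume "h \<in> W"
    then show "(\<Sum>n. (norm (ip h (\<psi> n)))\<^sup>2) \<le> max A B * (norm h)\<^sup>2"
      using AB(2) max_bound[of h] by (blast intro: order_trans)
  qed (use AB \<psi> assms(3,4) in auto)
  show ?thesis
    unfolding Let_def mp_inverse_eq ker_D
    using is_bessel summable_frame_series bounded_operator_S range_S ex1_mp_inverse range_D ker_S
    by simp
qed

end
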